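(* Let $n\ge 2$ and $r\ge 0$ be integers, and for each $m$ let $K_m$ be the complete graph on $[m]$. Then \[ \mathrm{Inc}(\mathbb{N})_{n,n+r}(I(K_n)) = I(K_{n+r}). \]
   Context: Let $k$ be a field, $R_m=k[x_1,\dots,x_m]$ and $[m]=\{1,\dots,m\}$. For $n\le m$, $\mathrm{Inc}(\mathbb{N})_{n,m}$ is the set of strictly increasing functions $\pi:[n]\to[m]$; each such $\pi$ induces the $k$-algebra homomorphism $\pi:R_n\to R_m$, $x_i\mapsto x_{\pi(i)}$. For an ideal $I\subseteq R_n$, $\mathrm{Inc}(\mathbb{N})_{n,m}(I):=\sum_{\pi\in\mathrm{Inc}(\mathbb{N})_{n,m}}\pi(I)R_m$, the ideal of $R_m$ generated by the images of $I$ under all such $\pi$. The edge ideal of a simple graph $G$ on $[n]$ is $I(G)=(x_ix_j : \{i,j\}\in E(G))\subseteq R_n$. *)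

theory Defs
  imports "HOL-Library.Poly_Mapping" "HOL-Library.FuncSet" "HOL-Algebra.QuotRing"
begin

text \<open>
  A polynomial in the variables $x_i$ ($i$ a natural number) over $k$ is a finitely supported map
  from exponent vectors to coefficients; its multiplication is the convolution product of
  \<^theory>\<open>HOL-Library.Poly_Mapping\<close>. The ring $R_m = k[x_1,\dots,x_m]$ is the subring of
  polynomials involving only $x_1,\dots,x_m$, viewed as a ring with carrier so that the ideal
  theory of \<^theory>\<open>HOL-Algebra.Ideal\<close> applies inside $R_m$.
\<close>

type_synonym 'k mpoly = "(nat \<Rightarrow>\<^sub>0 nat) \<Rightarrow>\<^sub>0 'k"

definition mvar :: "nat \<Rightarrow> 'k::comm_ring_1 mpoly" where
  "mvar i = Poly_Mapping.single (Poly_Mapping.single i 1) 1"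

definition mconst :: "'k::comm_ring_1 \<Rightarrow> 'k mpoly" where
  "mconst c = Poly_Mapping.single 0 c"

definition poly_ring :: "nat \<Rightarrow> 'k::comm_ring_1 mpoly ring" where
  "poly_ring m =
    \<lparr>carrier = {p. \<forall>t \<in> Poly_Mapping.keys p. Poly_Mapping.keys t \<subseteq> {1..m}},
     mult = (*), one = 1, zero = 0, add = (+)\<rparr>"

definition Inc_maps :: "nat \<Rightarrow> nat \<Rightarrow> (nat \<Rightarrow> nat) set" where
  "Inc_maps n m = {\<pi> \<in> {1..n} \<rightarrow>\<^sub>E {1..m}. strict_mono_on {1..n} \<pi>}"

text \<open>
  The $k$-algebra homomorphism with $x_i \mapsto x_{\pi(i)}$: every monomial
  $c \prod_i x_i^{t_i}$ of $p$ becomes $c \prod_i x_{\pi(i)}^{t_i}$.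
\<close>

definition induced_map :: "(nat \<Rightarrow> nat) \<Rightarrow> 'k::comm_ring_1 mpoly \<Rightarrow> 'k mpoly" where
  "induced_map \<pi> p =
    (\<Sum>t \<in> Poly_Mapping.keys p. mconst (Poly_Mapping.lookup p t) *
       (\<Prod>i \<in> Poly_Mapping.keys t. mvar (\<pi> i) ^ Poly_Mapping.lookup t i))"

text \<open>
  The sum over $\pi$ of the ideals $\pi(I) R_m$ is the ideal of $R_m$ generated by the union of
  the images $\pi(I)$.
\<close>

definition Inc_ideal :: "nat \<Rightarrow> nat \<Rightarrow> 'k::comm_ring_1 mpoly set \<Rightarrow> 'k mpoly set" where
  "Inc_ideal n m I = Idl\<^bsub>poly_ring m\<^esub> (\<Union>\<pi> \<in> Inc_maps n m. induced_map \<pi> ` I)"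

text \<open>A simple graph on the vertex set $\{1,\dots,n\}$ is given by its set of edges.\<close>

definition simple_graph :: "nat \<Rightarrow> nat set set \<Rightarrow> bool" where
  "simple_graph n E \<longleftrightarrow> (\<forall>e \<in> E. e \<subseteq> {1..n} \<and> card e = 2)"

definition complete_graph :: "nat \<Rightarrow> nat set set" where
  "complete_graph n = {e. e \<subseteq> {1..n} \<and> card e = 2}"

definition edge_ideal :: "nat \<Rightarrow> nat set set \<Rightarrow> 'k::comm_ring_1 mpoly set" where
  "edge_ideal n E = Idl\<^bsub>poly_ring n\<^esub> {mvar i * mvar j | i j. {i, j} \<in> E}"

lemma simple_graph_complete: "simple_graph n (complete_graph n)"
  by (simp add: simple_graph_def complete_graph_def)

lemma poly_ring_carrier:
  "p \<in> carrier (poly_ring m) \<longleftrightarrow> (\<forall>t \<in> Poly_Mapping.keys p. Poly_Mapping.keys t \<subseteq> {1..m})"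
  by (simp add: poly_ring_def)

lemma poly_ring_simps [simp]:
  "mult (poly_ring m) = (*)" "one (poly_ring m) = 1"
  "zero (poly_ring m) = 0" "add (poly_ring m) = (+)"
  by (simp_all add: poly_ring_def)

lemma poly_ring_zero_closed: "0 \<in> carrier (poly_ring m)"
  by (simp add: poly_ring_carrier)

lemma poly_ring_one_closed: "1 \<in> carrier (poly_ring m)"
  by (simp add: poly_ring_carrier)

lemma poly_ring_add_closed:
  "p \<in> carrier (poly_ring m) \<Longrightarrow> q \<in> carrier (poly_ring m) \<Longrightarrow> p + q \<in> carrier (poly_ring m)"
  using Poly_Mapping.keys_add[of p q] unfolding poly_ring_carrier by blast

lemma poly_ring_mult_closed:
  assumes "p \<in> carrier (poly_ring m)" "q \<in> carrier (poly_ring m)"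
  shows "p * q \<in> carrier (poly_ring m)"
proof -
  have "Poly_Mapping.keys t \<subseteq> {1..m}" if t: "t \<in> Poly_Mapping.keys (p * q)" for t
  proof -
    obtain a b where "t = a + b" "a \<in> Poly_Mapping.keys p" "b \<in> Poly_Mapping.keys q"
      using Poly_Mapping.keys_mult[of p q] t by blast
    then show ?thesis
      using Poly_Mapping.keys_add[of a b] assms unfolding poly_ring_carrier by blast
  qed
  then show ?thesis by (simp add: poly_ring_carrier)
qed

lemma cring_poly_ring: "cring (poly_ring m :: 'k::comm_ring_1 mpoly ring)"
proof (rule cringI)
  show "abelian_group (poly_ring m :: 'k mpoly ring)"
  proof (rule abelian_groupI)
    show "\<exists>y \<in> carrier (poly_ring m). y \<oplus>\<^bsub>poly_ring m\<^esub> x = \<zero>\<^bsub>poly_ring m\<^esub>"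
      if "x \<in> carrier (poly_ring m)" for x :: "'k mpoly"
      using that by (intro bexI[of _ "- x"]) (auto simp: poly_ring_carrier)
  qed (auto simp: algebra_simps poly_ring_zero_closed intro: poly_ring_add_closed)
  show "comm_monoid (poly_ring m :: 'k mpoly ring)"
    by (rule comm_monoidI) (auto simp: algebra_simps poly_ring_one_closed intro: poly_ring_mult_closed)
qed (auto simp: algebra_simps)

lemma mvar_in_poly_ring: "i \<in> {1..m} \<Longrightarrow> mvar i \<in> carrier (poly_ring m)"
  by (simp add: mvar_def poly_ring_carrier)

lemma mconst_in_poly_ring: "mconst c \<in> carrier (poly_ring m)"
  by (simp add: mconst_def poly_ring_carrier)

text \<open>\<^const>\<open>induced_map\<close> is indeed the $k$-algebra homomorphism determined by $\pi$.\<close>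

lemma induced_map_mvar: "induced_map \<pi> (mvar i) = mvar (\<pi> i)"
  by (simp add: induced_map_def mvar_def mconst_def)

lemma induced_map_mconst: "induced_map \<pi> (mconst c) = mconst c"
  by (simp add: induced_map_def mconst_def)

definition mon_map :: "(nat \<Rightarrow> nat) \<Rightarrow> (nat \<Rightarrow>\<^sub>0 nat) \<Rightarrow> 'k::comm_ring_1 mpoly" where
  "mon_map \<pi> t = (\<Prod>i \<in> Poly_Mapping.keys t. mvar (\<pi> i) ^ Poly_Mapping.lookup t i)"

lemma mon_map_superset:
  assumes "finite A" "Poly_Mapping.keys t \<subseteq> A"
  shows "mon_map \<pi> t = (\<Prod>i \<in> A. mvar (\<pi> i) ^ Poly_Mapping.lookup t i)"
  unfolding mon_map_def
  by (rule prod.mono_neutral_left) (use assms in \<open>auto simp: in_keys_iff\<close>)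

lemma mon_map_add: "mon_map \<pi> (s + t) = mon_map \<pi> s * mon_map \<pi> t"
proof -
  let ?A = "Poly_Mapping.keys s \<union> Poly_Mapping.keys t"
  have "mon_map \<pi> (s + t) = (\<Prod>i \<in> ?A. mvar (\<pi> i) ^ Poly_Mapping.lookup (s + t) i)"
    by (rule mon_map_superset) (simp_all add: Poly_Mapping.keys_add)
  also have "\<dots> = (\<Prod>i \<in> ?A. mvar (\<pi> i) ^ Poly_Mapping.lookup s i) *
                   (\<Prod>i \<in> ?A. mvar (\<pi> i) ^ Poly_Mapping.lookup t i)"
    by (simp add: lookup_add power_add prod.distrib)
  also have "\<dots> = mon_map \<pi> s * mon_map \<pi> t"
    by (simp add: mon_map_superset[of ?A s \<pi>] mon_map_superset[of ?A t \<pi>])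
  finally show ?thesis .
qed

lemma induced_map_superset:
  assumes "finite A" "Poly_Mapping.keys p \<subseteq> A"
  shows "induced_map \<pi> p = (\<Sum>t \<in> A. mconst (Poly_Mapping.lookup p t) * mon_map \<pi> t)"
  unfolding induced_map_def mon_map_def[symmetric]
  by (rule sum.mono_neutral_left) (use assms in \<open>auto simp: in_keys_iff mconst_def\<close>)

lemma induced_map_add: "induced_map \<pi> (p + q) = induced_map \<pi> p + induced_map \<pi> q"
proof -
  let ?A = "Poly_Mapping.keys p \<union> Poly_Mapping.keys q"
  have "induced_map \<pi> (p + q)
      = (\<Sum>t \<in> ?A. mconst (Poly_Mapping.lookup (p + q) t) * mon_map \<pi> t)"
    by (rule induced_map_superset) (simp_all add: Poly_Mapping.keys_add)
  also have "\<dots> = (\<Sum>t \<in> ?A. mconst (Poly_Mapping.lookup p t) * mon_map \<pi> t) +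
                   (\<Sum>t \<in> ?A. mconst (Poly_Mapping.lookup q t) * mon_map \<pi> t)"
    by (simp add: mconst_def lookup_add single_add distrib_right sum.distrib)
  also have "\<dots> = induced_map \<pi> p + induced_map \<pi> q"
    using induced_map_superset[of ?A p \<pi>] induced_map_superset[of ?A q \<pi>] by simp
  finally show ?thesis .
qed

lemma induced_map_zero: "induced_map \<pi> 0 = 0"
  by (simp add: induced_map_def)

lemma induced_map_sum: "induced_map \<pi> (sum f A) = (\<Sum>a \<in> A. induced_map \<pi> (f a))"
  by (induction A rule: infinite_finite_induct) (simp_all add: induced_map_zero induced_map_add)

lemma induced_map_single:
  "induced_map \<pi> (Poly_Mapping.single t c) = mconst c * mon_map \<pi> t"
  using induced_map_superset[of "{t}" "Poly_Mapping.single t c" \<pi>] by simp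

lemma mpoly_sum_monomials:
  "p = (\<Sum>t \<in> Poly_Mapping.keys p. Poly_Mapping.single t (Poly_Mapping.lookup p t))"
  by (rule poly_mapping_eqI)
    (simp add: lookup_sum lookup_single when_def in_keys_iff)

lemma induced_map_mult: "induced_map \<pi> (p * q) = induced_map \<pi> p * induced_map \<pi> q"
proof -
  let ?S = "\<lambda>p t. Poly_Mapping.single t (Poly_Mapping.lookup p t)"
  have mono: "induced_map \<pi> (?S p s * ?S q t) = induced_map \<pi> (?S p s) * induced_map \<pi> (?S q t)"
    for s t
  proof -
    have "mconst (a * b) = mconst a * mconst b" for a b :: 'a
      by (simp add: mconst_def mult_single)
    then show ?thesis
      by (simp add: mult_single induced_map_single mon_map_add algebra_simps)
  qed
  have "p * q = (\<Sum>s \<in> Poly_Mapping.keys p. ?S p s) * (\<Sum>t \<in> Poly_Mapping.keys q. ?S q t)"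
    using mpoly_sum_monomials[of p] mpoly_sum_monomials[of q] by simp
  also have "\<dots> = (\<Sum>s \<in> Poly_Mapping.keys p. \<Sum>t \<in> Poly_Mapping.keys q. ?S p s * ?S q t)"
    by (rule sum_product)
  finally have "induced_map \<pi> (p * q) =
      (\<Sum>s \<in> Poly_Mapping.keys p. \<Sum>t \<in> Poly_Mapping.keys q.
         induced_map \<pi> (?S p s) * induced_map \<pi> (?S q t))"
    by (simp only: induced_map_sum mono)
  also have "\<dots> = (\<Sum>s \<in> Poly_Mapping.keys p. induced_map \<pi> (?S p s)) *
                   (\<Sum>t \<in> Poly_Mapping.keys q. induced_map \<pi> (?S q t))"
    by (rule sum_product[symmetric])
  also have "\<dots> = induced_map \<pi> p * induced_map \<pi> q"
    using mpoly_sum_monomials[of p] mpoly_sum_monomials[of q] by (simp flip: induced_map_sum)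
  finally show ?thesis .
qed

lemma induced_map_one: "induced_map \<pi> 1 = 1"
  using induced_map_mconst[of \<pi> 1] by (simp add: mconst_def)

lemma induced_map_closed:
  fixes p :: "'k::comm_ring_1 mpoly"
  assumes \<pi>: "\<pi> \<in> Inc_maps n m" and p: "p \<in> carrier (poly_ring n)"
  shows "induced_map \<pi> p \<in> carrier (poly_ring m)"
proof -
  let ?C = "carrier (poly_ring m) :: 'k mpoly set"
  have pow: "q ^ e \<in> ?C" if "q \<in> ?C" for q e
  proof (induction e)
    case 0
    show ?case by (simp add: poly_ring_one_closed)
  next
    case (Suc e)
    show ?case using poly_ring_mult_closed[OF that Suc] by simp
  qed
  have prod: "prod f A \<in> ?C" if "\<And>i. i \<in> A \<Longrightarrow> f i \<in> ?C" for f and A :: "nat set"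
    using that
  proof (induction A rule: infinite_finite_induct)
    case (insert a A)
    then have "f a * prod f A \<in> ?C" by (intro poly_ring_mult_closed) blast+
    then show ?case using insert.hyps by simp
  qed (simp_all add: poly_ring_one_closed)
  have sum: "sum f A \<in> ?C" if "\<And>t. t \<in> A \<Longrightarrow> f t \<in> ?C" for f and A :: "(nat \<Rightarrow>\<^sub>0 nat) set"
    using that
  proof (induction A rule: infinite_finite_induct)
    case (insert a A)
    then have "f a + sum f A \<in> ?C" by (intro poly_ring_add_closed) blast+
    then show ?case using insert.hyps by simp
  qed (simp_all add: poly_ring_zero_closed)
  show ?thesis
    unfolding induced_map_def
  proof (intro sum poly_ring_mult_closed prod pow mconst_in_poly_ring mvar_in_poly_ring)
    fix t i
    assume "t \<in> Poly_Mapping.keys p" "i \<in> Poly_Mapping.keys t"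
    then have "i \<in> {1..n}" using p unfolding poly_ring_carrier by blast
    then show "\<pi> i \<in> {1..m}" using \<pi> unfolding Inc_maps_def by blast
  qed
qed

lemma induced_map_ring_hom:
  assumes "\<pi> \<in> Inc_maps n m"
  shows "induced_map \<pi> \<in> ring_hom (poly_ring n) (poly_ring m)"
  using induced_map_closed[OF assms]
  by (intro ring_hom_memI)
    (simp_all add: induced_map_add induced_map_mult induced_map_one)

end

theory Submission
  imports Defs "HOL-Library.Infinite_Set"
begin

text \<open>
  Both sides are generated by products of two variables, so the statement is about graphs.
  Since each \<open>induced_map \<pi>\<close> is a ring homomorphism, the ideal generated by the images of an
  ideal is already generated by the images of its generators (\<open>Idl_UN_hom_image_Idl\<close>). It sends
  $x_i x_j$ to $x_{\pi(i)} x_{\pi(j)}$, so the operation on edge ideals is the edge ideal of the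
  union of the graphs $\pi(G)$ (\<open>Inc_ideal_edge_ideal\<close>).

  What remains is that the strictly increasing images of $K_n$ cover exactly $K_{n+r}$. They lie in
  $K_{n+r}$ because each $\pi$ is injective. Conversely, as $n \ge 2$, the two ends of any edge of
  $K_{n+r}$ lie in some $n$-element subset of $\{1,\dots,n+r\}$, and listing that subset in
  increasing order gives a $\pi$ whose image contains the edge
  (\<open>complete_graph_covered_by_Inc_maps\<close>).
\<close>

text \<open>
  The preimage under a homomorphism of an ideal is an ideal. Hence if the ideal generated by the
  images of \<open>A\<close> is pulled back along any \<open>h \<in> H\<close>, the result is an ideal containing \<open>A\<close>, and
  therefore contains \<open>Idl A\<close>.
\<close>

lemma Idl_UN_hom_image_Idl:
  assumes R: "ring R" and S: "ring S" and H: "H \<subseteq> ring_hom R S" and A: "A \<subseteq> carrier R"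
  shows "Idl\<^bsub>S\<^esub> (\<Union>h\<in>H. h ` (Idl\<^bsub>R\<^esub> A)) = Idl\<^bsub>S\<^esub> (\<Union>h\<in>H. h ` A)"
proof
  interpret R: ring R by fact
  interpret S: ring S by fact
  have closed: "(\<Union>h\<in>H. h ` B) \<subseteq> carrier S" if "B \<subseteq> carrier R" for B
    using H that by (force simp: ring_hom_def)
  have Idl_A: "ideal (Idl\<^bsub>R\<^esub> A) R"
    by (rule R.genideal_ideal[OF A])
  then have Idl_A_carrier: "Idl\<^bsub>R\<^esub> A \<subseteq> carrier R"
    by (rule ideal.Icarr[THEN subsetI])
  let ?J = "Idl\<^bsub>S\<^esub> (\<Union>h\<in>H. h ` A)"
  have J: "ideal ?J S"
    by (rule S.genideal_ideal[OF closed[OF A]])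
  have gens: "(\<Union>h\<in>H. h ` A) \<subseteq> ?J"
    by (rule S.genideal_self[OF closed[OF A]])
  have "h ` (Idl\<^bsub>R\<^esub> A) \<subseteq> ?J" if h: "h \<in> H" for h
  proof -
    interpret h: ring_hom_ring R S h
      using H h by (intro ring_hom_ringI2 R S) blast
    have "Idl\<^bsub>R\<^esub> A \<subseteq> {x \<in> carrier R. h x \<in> ?J}"
      using A gens h by (intro R.genideal_minimal h.ideal_vimage[OF J]) blast
    then show ?thesis by blast
  qed
  then show "Idl\<^bsub>S\<^esub> (\<Union>h\<in>H. h ` (Idl\<^bsub>R\<^esub> A)) \<subseteq> ?J"
    by (intro S.genideal_minimal[OF J]) blast
  show "?J \<subseteq> Idl\<^bsub>S\<^esub> (\<Union>h\<in>H. h ` (Idl\<^bsub>R\<^esub> A))"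
    using R.genideal_self[OF A] by (intro S.subset_Idl_subset closed Idl_A_carrier) blast
qed

lemma Inc_ideal_edge_ideal:
  assumes G: "simple_graph n E"
  shows "Inc_ideal n m (edge_ideal n E :: 'k::comm_ring_1 mpoly set)
       = edge_ideal m (\<Union>\<pi> \<in> Inc_maps n m. image \<pi> ` E)"
proof -
  let ?A = "{mvar i * mvar j | i j. {i, j} \<in> E} :: 'k mpoly set"
  let ?H = "induced_map ` Inc_maps n m :: ('k mpoly \<Rightarrow> 'k mpoly) set"
  let ?E' = "\<Union>\<pi> \<in> Inc_maps n m. image \<pi> ` E"
  have A: "?A \<subseteq> carrier (poly_ring n)"
  proof
    fix p :: "'k mpoly"
    assume "p \<in> ?A"
    then obtain i j where p: "p = mvar i * mvar j" and "{i, j} \<in> E" by blast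
    then have "i \<in> {1..n}" "j \<in> {1..n}"
      using G unfolding simple_graph_def by blast+
    then show "p \<in> carrier (poly_ring n)"
      unfolding p by (intro poly_ring_mult_closed mvar_in_poly_ring)
  qed
  have "(\<Union>h\<in>?H. h ` ?A) = {mvar i * mvar j | i j. {i, j} \<in> ?E'}"
  proof (intro equalityI subsetI)
    fix p :: "'k mpoly"
    assume "p \<in> (\<Union>h\<in>?H. h ` ?A)"
    then obtain \<pi> i j where \<pi>: "\<pi> \<in> Inc_maps n m" and ij: "{i, j} \<in> E"
      and p: "p = induced_map \<pi> (mvar i * mvar j)" by blast
    have "{\<pi> i, \<pi> j} = \<pi> ` {i, j}" by simp
    then have "{\<pi> i, \<pi> j} \<in> ?E'" using \<pi> ij by blast
    moreover have "p = mvar (\<pi> i) * mvar (\<pi> j)"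
      unfolding p by (simp add: induced_map_mult induced_map_mvar)
    ultimately show "p \<in> {mvar i * mvar j | i j. {i, j} \<in> ?E'}" by blast
  next
    fix p :: "'k mpoly"
    assume "p \<in> {mvar i * mvar j | i j. {i, j} \<in> ?E'}"
    then obtain i j where p: "p = mvar i * mvar j" and "{i, j} \<in> ?E'" by blast
    from this(2) obtain \<pi> e where \<pi>: "\<pi> \<in> Inc_maps n m" and e: "e \<in> E"
      and ij: "{i, j} = \<pi> ` e" by (elim UN_E imageE)
    have "card e = 2"
      using G e unfolding simple_graph_def by blast
    then obtain a b where ab: "e = {a, b}"
      unfolding card_2_iff by blast
    \<comment> \<open>Edges are unordered, so the ends of \<open>e\<close> may be matched with \<open>i\<close>, \<open>j\<close> in either order.\<close>
    have "i = \<pi> a \<and> j = \<pi> b \<or> i = \<pi> b \<and> j = \<pi> a"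
      using ij unfolding ab by (simp add: doubleton_eq_iff)
    then have "p = induced_map \<pi> (mvar a * mvar b)"
      unfolding p by (auto simp: induced_map_mult induced_map_mvar mult.commute)
    moreover have "mvar a * mvar b \<in> ?A" using e ab by blast
    ultimately show "p \<in> (\<Union>h\<in>?H. h ` ?A)" using \<pi> by blast
  qed
  moreover have "Idl\<^bsub>poly_ring m\<^esub> (\<Union>h\<in>?H. h ` (Idl\<^bsub>poly_ring n\<^esub> ?A))
      = Idl\<^bsub>poly_ring m\<^esub> (\<Union>h\<in>?H. h ` ?A)"
    using A induced_map_ring_hom
    by (intro Idl_UN_hom_image_Idl cring.axioms(1) cring_poly_ring) blast+
  ultimately show ?thesis
    unfolding Inc_ideal_def edge_ideal_def by simp
qed

lemma Inc_maps_enumerate: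
  assumes S: "S \<subseteq> {1..m}" and card: "card S = n"
  obtains \<pi> where "\<pi> \<in> Inc_maps n m" and "\<pi> ` {1..n} = S"
proof -
  have "finite S" using S finite_subset by blast
  then obtain h where h: "bij_betw h {..<n} S" and mono: "strict_mono_on {..<n} h"
    using ex_bij_betw_strict_mono_card[of S] card by blast
  \<comment> \<open>The enumeration \<open>h\<close> counts from \<open>0\<close>, the variables from \<open>1\<close>.\<close>
  define \<pi> where "\<pi> = restrict (\<lambda>i. h (i - 1)) {1..n}"
  have "\<pi> ` {1..n} = \<pi> ` Suc ` {..<n}"
    by (simp add: image_Suc_lessThan)
  also have "\<dots> = h ` {..<n}"
    unfolding image_image by (intro image_cong) (auto simp: \<pi>_def)
  also have "\<dots> = S"
    by (rule bij_betw_imp_surj_on[OF h])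
  finally have image: "\<pi> ` {1..n} = S" .
  have "strict_mono_on {1..n} \<pi>"
  proof (rule strict_mono_onI)
    fix r s
    assume "r \<in> {1..n}" "s \<in> {1..n}" "r < s"
    then show "\<pi> r < \<pi> s"
      using strict_mono_onD[OF mono, of "r - 1" "s - 1"] by (auto simp: \<pi>_def)
  qed
  moreover have "\<pi> \<in> {1..n} \<rightarrow>\<^sub>E {1..m}"
    using image S by (auto simp: \<pi>_def)
  ultimately show ?thesis using that image by (simp add: Inc_maps_def)
qed

lemma complete_graph_covered_by_Inc_maps:
  assumes "2 \<le> n" and "n \<le> m"
  shows "(\<Union>\<pi> \<in> Inc_maps n m. image \<pi> ` complete_graph n) = complete_graph m"
proof (intro equalityI subsetI)
  fix e'
  assume "e' \<in> (\<Union>\<pi> \<in> Inc_maps n m. image \<pi> ` complete_graph n)"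
  then obtain \<pi> e where \<pi>: "\<pi> \<in> Inc_maps n m" and e: "e \<subseteq> {1..n}" "card e = 2"
    and e': "e' = \<pi> ` e" unfolding complete_graph_def by blast
  have "inj_on \<pi> e"
    using \<pi> e(1) unfolding Inc_maps_def by (blast intro: strict_mono_on_imp_inj_on inj_on_subset)
  moreover have "\<pi> ` e \<subseteq> {1..m}"
    using \<pi> e(1) unfolding Inc_maps_def by blast
  ultimately show "e' \<in> complete_graph m"
    using e by (simp add: e' complete_graph_def card_image)
next
  fix e
  assume "e \<in> complete_graph m"
  then have e: "e \<subseteq> {1..m}" "card e = 2" by (simp_all add: complete_graph_def)
  obtain S where S: "e \<subseteq> S" "S \<subseteq> {1..m}" "card S = n"
    using exists_subset_between[of e n "{1..m}"] e assms by auto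
  obtain \<pi> where \<pi>: "\<pi> \<in> Inc_maps n m" and image: "\<pi> ` {1..n} = S"
    using Inc_maps_enumerate S by blast
  obtain d where d: "d \<subseteq> {1..n}" "e = \<pi> ` d"
    using S(1) image by (metis subset_imageE)
  have "inj_on \<pi> d"
    using \<pi> d(1) unfolding Inc_maps_def by (blast intro: strict_mono_on_imp_inj_on inj_on_subset)
  then have "card d = 2" using e(2) d(2) by (simp add: card_image)
  then have "d \<in> complete_graph n" using d(1) by (simp add: complete_graph_def)
  then show "e \<in> (\<Union>\<pi> \<in> Inc_maps n m. image \<pi> ` complete_graph n)"
    using \<pi> d(2) by blast
qed

theorem lemma3p11:
  fixes n r :: nat
  assumes "n \<ge> 2"
  shows "Inc_ideal n (n + r) (edge_ideal n (complete_graph n) :: 'k::field mpoly set)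
       = edge_ideal (n + r) (complete_graph (n + r))"
  using assms
  by (simp add: Inc_ideal_edge_ideal[OF simple_graph_complete] complete_graph_covered_by_Inc_maps)

end
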